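(* There exists no cubic $4$-circulant nut graph, and there exists no cubic $5$-circulant nut graph.
   Context: A nut graph is a simple graph with at least two vertices whose adjacency matrix has a one-dimensional null space spanned by a vector with no zero entries. For a positive integer $\ell$, an $\ell$-circulant graph is a graph that admits a cyclic group of automorphisms having exactly $\ell$ vertex orbits, all of equal size. A cubic graph is a $3$-regular graph. *)

theory Defs
  imports "HOL-Analysis.Analysis" "HOL-Algebra.Algebra"
begin

text \<open>
  A finite simple graph is given by its adjacency relation on a finite vertex type.
\<close>

definition simple_graph :: "('v::finite \<Rightarrow> 'v \<Rightarrow> bool) \<Rightarrow> bool" where
  "simple_graph E \<longleftrightarrow> symp E \<and> irreflp E"

definition cubic :: "('v::finite \<Rightarrow> 'v \<Rightarrow> bool) \<Rightarrow> bool" where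
  "cubic E \<longleftrightarrow> (\<forall>v. card {w. E v w} = 3)"

definition adjacency_matrix :: "('v::finite \<Rightarrow> 'v \<Rightarrow> bool) \<Rightarrow> real ^ 'v ^ 'v" where
  "adjacency_matrix E = (\<chi> u v. if E u v then 1 else 0)"

definition null_space :: "real ^ 'n ^ 'm \<Rightarrow> (real ^ 'n) set" where
  "null_space A = {x. A *v x = 0}"

definition nut_graph :: "('v::finite \<Rightarrow> 'v \<Rightarrow> bool) \<Rightarrow> bool" where
  "nut_graph E \<longleftrightarrow>
     simple_graph E \<and> CARD('v) \<ge> 2 \<and>
     dim (null_space (adjacency_matrix E)) = 1 \<and>
     (\<exists>x. null_space (adjacency_matrix E) = span {x} \<and> (\<forall>v. x $ v \<noteq> 0))"

definition graph_automorphisms :: "('v \<Rightarrow> 'v \<Rightarrow> bool) \<Rightarrow> ('v \<Rightarrow> 'v) set" where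
  "graph_automorphisms E = {f \<in> Bij UNIV. \<forall>u v. E (f u) (f v) \<longleftrightarrow> E u v}"

definition automorphism_group :: "('v \<Rightarrow> 'v \<Rightarrow> bool) \<Rightarrow> ('v \<Rightarrow> 'v) monoid" where
  "automorphism_group E = BijGroup UNIV \<lparr>carrier := graph_automorphisms E\<rparr>"

lemma subgroup_graph_automorphisms: "subgroup (graph_automorphisms E) (BijGroup UNIV)"
proof (rule group.subgroupI[OF group_BijGroup])
  show "graph_automorphisms E \<subseteq> carrier (BijGroup UNIV)"
    by (auto simp: graph_automorphisms_def BijGroup_def)
  have "id \<in> graph_automorphisms E"
    by (auto simp: graph_automorphisms_def Bij_def)
  then show "graph_automorphisms E \<noteq> {}" by blast
next
  fix f assume f: "f \<in> graph_automorphisms E"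
  then have bij: "bij f" and adj: "\<And>u v. E (f u) (f v) \<longleftrightarrow> E u v"
    by (auto simp: graph_automorphisms_def Bij_def)
  have "inv\<^bsub>BijGroup UNIV\<^esub> f = inv_into UNIV f"
    using f by (subst inv_BijGroup) (auto simp: graph_automorphisms_def)
  moreover have "E (inv_into UNIV f u) (inv_into UNIV f v) \<longleftrightarrow> E u v" for u v
    using adj[of "inv_into UNIV f u" "inv_into UNIV f v"] bij
    by (simp add: bij_is_surj surj_f_inv_f)
  moreover have "inv_into UNIV f \<in> Bij UNIV"
    using bij by (simp add: Bij_def bij_imp_bij_inv)
  ultimately show "inv\<^bsub>BijGroup UNIV\<^esub> f \<in> graph_automorphisms E"
    by (simp add: graph_automorphisms_def)
next
  fix f g assume "f \<in> graph_automorphisms E" "g \<in> graph_automorphisms E"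
  then show "f \<otimes>\<^bsub>BijGroup UNIV\<^esub> g \<in> graph_automorphisms E"
    by (auto simp: graph_automorphisms_def BijGroup_def compose_Bij)
       (auto simp: compose_def)
qed

lemma group_automorphism_group: "group (automorphism_group E)"
  unfolding automorphism_group_def
  by (rule subgroup.subgroup_is_group[OF subgroup_graph_automorphisms group_BijGroup])

definition l_circulant :: "nat \<Rightarrow> ('v::finite \<Rightarrow> 'v \<Rightarrow> bool) \<Rightarrow> bool" where
  "l_circulant l E \<longleftrightarrow>
     (\<exists>H. subgroup H (automorphism_group E) \<and>
          (let G = automorphism_group E \<lparr>carrier := H\<rparr> in
             cyclic_group G \<and>
             card (orbits G UNIV (\<lambda>g. g)) = l \<and>
             (\<forall>A \<in> orbits G UNIV (\<lambda>g. g). \<forall>B \<in> orbits G UNIV (\<lambda>g. g). card A = card B)))"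

end

theory Submission
  imports Defs
begin

text \<open>
  Let \<open>x\<close> span the kernel and let \<open>f\<close> generate the cyclic group. Then \<open>x \<circ> f = c x\<close> with
  \<open>c = \<plusminus>1\<close>, so \<open>\<bar>x\<bar>\<close> is constant on orbits; list the orbits by increasing value
  \<open>a\<^sub>0 \<le> a\<^sub>1 \<le> \<dots>\<close> of \<open>\<bar>x\<bar>\<close>. Counting the neighbours of a vertex of orbit \<open>i\<close> in orbit \<open>k\<close>,
  with sign according to whether \<open>x\<close> has the same sign at both ends, gives an integer matrix \<open>B\<close>,
  symmetric because all orbits have the same size, with \<open>B a = 0\<close>. A vanishing signed sum of three
  positive numbers has exactly one minority sign, carried by the largest of the three, so every row
  of \<open>B\<close> is \<open>\<plusminus>(e\<^sub>p + e\<^sub>q - e\<^sub>r)\<close> with \<open>p \<le> q < r\<close> and \<open>a\<^sub>r = a\<^sub>p + a\<^sub>q\<close>. An odd diagonal entry comes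
  from the edge joining \<open>v\<close> to its image under the half turn \<open>f\<^bsup>m/2\<^esup>\<close>, whose sign does not depend on
  the orbit, so all odd diagonal entries agree. For 4 or 5 orbits only a few dozen matrices have
  these properties, and for each of them the equations \<open>a\<^sub>r = a\<^sub>p + a\<^sub>q\<close> have no solution with
  \<open>0 < a\<^sub>0 \<le> a\<^sub>1 \<le> \<dots>\<close>.
\<close>

section \<open>Symmetric matrices with rows of the given shape\<close>

text \<open>A shape is a triple \<open>(p, q, r)\<close> together with one of the two rows \<open>\<plusminus>(e\<^sub>p + e\<^sub>q - e\<^sub>r)\<close>.\<close>

type_synonym row_shape = "(nat \<times> nat \<times> nat) \<times> int list"

definition shape_row :: "nat \<Rightarrow> int \<Rightarrow> nat \<Rightarrow> nat \<Rightarrow> nat \<Rightarrow> int list" where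
  "shape_row n e p q r = map (\<lambda>k. e * (of_bool (k = p) + of_bool (k = q) - of_bool (k = r))) [0..<n]"

definition row_shapes :: "nat \<Rightarrow> int list \<Rightarrow> row_shape list" where
  "row_shapes n es = [((p, q, r), shape_row n e p q r).
     r \<leftarrow> [0..<n], q \<leftarrow> [0..<r], p \<leftarrow> [0..<Suc q], e \<leftarrow> es]"

text \<open>Written with \<open>if\<close> so that symbolic evaluation stops at the first mismatch.\<close>

fun agree :: "int list \<Rightarrow> int list \<Rightarrow> bool" where
  "agree (x # xs) (y # ys) = (if x = y then agree xs ys else False)"
| "agree _ _ = True"

text \<open>
  Here \<open>symmetric_arrays F S j\<close> lists the first \<open>j + 1\<close> rows. The initial row has its own list of
  shapes because its sign can be normalised to \<open>1\<close>.
\<close>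

fun symmetric_arrays :: "row_shape list \<Rightarrow> row_shape list \<Rightarrow> nat \<Rightarrow> row_shape list list" where
  "symmetric_arrays F S 0 = map (\<lambda>t. [t]) F"
| "symmetric_arrays F S (Suc j) = concat (map (\<lambda>M.
     map (\<lambda>t. M @ [t]) (filter (\<lambda>t. agree (map (\<lambda>u. snd u ! Suc j) M) (snd t)) S))
     (symmetric_arrays F S j))"

text \<open>Diagonal entries of such rows lie between -2 and 2, so the only odd ones are 1 and -1,
  and exactly their coexistence is excluded.\<close>

definition diagonal_ok :: "nat \<Rightarrow> row_shape list \<Rightarrow> bool" where
  "diagonal_ok n M \<longleftrightarrow> \<not> (list_ex (\<lambda>i. snd (M ! i) ! i = 1) [0..<n] \<and>
                          list_ex (\<lambda>i. snd (M ! i) ! i = -1) [0..<n])"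

text \<open>A triple \<open>(p, q, r)\<close> stands for the equation
  \<open>a r = a p + a q\<close>, so each surviving array turns into a system of such
  equations.\<close>

definition systems :: "nat \<Rightarrow> (nat \<times> nat \<times> nat) list list" where
  "systems n = map (map fst) (filter (diagonal_ok n)
     (symmetric_arrays (row_shapes n [1]) (row_shapes n [1, -1]) (n - 1)))"

section \<open>Completeness of the enumeration\<close>

lemma agree_iff_nth:
  "agree xs ys \<longleftrightarrow> (\<forall>i. i < length xs \<longrightarrow> i < length ys \<longrightarrow> xs ! i = ys ! i)"
proof (induction xs ys rule: agree.induct)
  case (1 x xs y ys)
  then show ?case by (auto simp: nth_Cons split: nat.splits)
qed auto

lemma snoc_in_symmetric_arrays:
  assumes "M \<in> set (symmetric_arrays F S j)" "t \<in> set S" "agree (map (\<lambda>u. snd u ! Suc j) M) (snd t)"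
  shows "M @ [t] \<in> set (symmetric_arrays F S (Suc j))"
proof -
  have "M @ [t] \<in> set (map (\<lambda>t. M @ [t]) (filter (\<lambda>t. agree (map (\<lambda>u. snd u ! Suc j) M) (snd t)) S))"
    unfolding set_map using assms(2,3) by (intro imageI) simp
  then show ?thesis
    unfolding symmetric_arrays.simps set_concat set_map[of _ "symmetric_arrays F S j"]
    by (rule UN_I[OF imageI[OF assms(1)]])
qed

text \<open>By symmetry each new row is tested against one column of the rows before it;
  \<open>agree\<close> stops at the shorter list, so the entries from the diagonal on stay
  free.\<close>

lemma symmetric_arrays_complete:
  assumes "T 0 \<in> set F"
    and "\<And>i. i \<le> j \<Longrightarrow> T i \<in> set S"
    and "\<And>i k. i \<le> j \<Longrightarrow> k \<le> j \<Longrightarrow> snd (T i) ! k = snd (T k) ! i"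
  shows "map T [0..<Suc j] \<in> set (symmetric_arrays F S j)"
  using assms
proof (induction j)
  case (Suc j)
  then have "map T [0..<Suc j] \<in> set (symmetric_arrays F S j)" by simp
  moreover have "agree (map (\<lambda>u. snd u ! Suc j) (map T [0..<Suc j])) (snd (T (Suc j)))"
    using Suc.prems(3) by (auto simp: agree_iff_nth simp del: upt_Suc)
  ultimately have "map T [0..<Suc j] @ [T (Suc j)] \<in> set (symmetric_arrays F S (Suc j))"
    using Suc.prems(2)[of "Suc j"] by (intro snoc_in_symmetric_arrays) auto
  then show ?case by simp
qed simp

lemma shape_row_in_row_shapes:
  assumes "p \<le> q" "q < r" "r < n" "e \<in> set es"
  shows "((p, q, r), shape_row n e p q r) \<in> set (row_shapes n es)"
  using assms by (force simp: row_shapes_def)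

lemma nth_shape_row:
  "k < n \<Longrightarrow> shape_row n e p q r ! k = e * (of_bool (k = p) + of_bool (k = q) - of_bool (k = r))"
  by (simp add: shape_row_def)

lemma systems_complete:
  assumes "n > 0" and T0: "T 0 \<in> set (row_shapes n [1])"
    and rows: "\<And>i. i < n \<Longrightarrow> T i \<in> set (row_shapes n [1, -1])"
    and sym: "\<And>i k. i < n \<Longrightarrow> k < n \<Longrightarrow> snd (T i) ! k = snd (T k) ! i"
    and diag: "\<And>i. i < n \<Longrightarrow> odd (snd (T i) ! i) \<Longrightarrow> snd (T i) ! i = s"
  shows "map (fst \<circ> T) [0..<n] \<in> set (systems n)"
proof -
  have "\<not> ((\<exists>i<n. snd (T i) ! i = 1) \<and> (\<exists>i<n. snd (T i) ! i = -1))"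
  proof
    assume "(\<exists>i<n. snd (T i) ! i = 1) \<and> (\<exists>i<n. snd (T i) ! i = -1)"
    then obtain i j where "i < n" "snd (T i) ! i = 1" "j < n" "snd (T j) ! j = -1" by blast
    then have "1 = s" "-1 = s" using diag[of i] diag[of j] by simp_all
    then show False by simp
  qed
  then have "diagonal_ok n (map T [0..<n])"
    by (auto simp: diagonal_ok_def list_ex_iff)
  moreover have "map T [0..<n] \<in> set (symmetric_arrays (row_shapes n [1]) (row_shapes n [1, -1]) (n - 1))"
    using symmetric_arrays_complete[of T _ "n - 1"] T0 rows sym \<open>n > 0\<close> by simp
  ultimately show ?thesis
    unfolding systems_def by (force simp flip: map_map)
qed

section \<open>Infeasibility of the linear systems\<close>

lemma systems_4_infeasible:
  fixes a :: "nat \<Rightarrow> real"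
  assumes "0 < a 0" "a 0 \<le> a 1" "a 1 \<le> a 2" "a 2 \<le> a 3"
  shows "list_all (\<lambda>ts. \<not> (\<forall>(p, q, r) \<in> set ts. a r = a p + a q)) (systems 4)"
proof -
  \<comment> \<open>Keeping \<open>P\<close> opaque, the evaluation leaves one goal \<open>P ts\<close> for each system \<open>ts\<close>.\<close>
  define P where "P = (\<lambda>ts. \<not> (\<forall>(p, q, r) \<in> set ts. a r = a p + a q))"
  have P: "P [] \<longleftrightarrow> False" "P ((p, q, r) # ts) \<longleftrightarrow> (a r = a p + a q \<longrightarrow> P ts)" for p q r ts
    by (auto simp: P_def)
  have "list_all P (systems 4)"
    by (code_simp, simp only: ball_simps P One_nat_def, intro conjI TrueI impI)
       (insert assms[unfolded One_nat_def], linarith+)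
  then show ?thesis by (simp add: P_def)
qed

lemma systems_5_infeasible:
  fixes a :: "nat \<Rightarrow> real"
  assumes "0 < a 0" "a 0 \<le> a 1" "a 1 \<le> a 2" "a 2 \<le> a 3" "a 3 \<le> a 4"
  shows "list_all (\<lambda>ts. \<not> (\<forall>(p, q, r) \<in> set ts. a r = a p + a q)) (systems 5)"
proof -
  \<comment> \<open>As with four orbits, \<open>P\<close> stays opaque while the systems are
    computed, so that only linear goals over the values of \<open>a\<close> remain.\<close>
  define P where "P = (\<lambda>ts. \<not> (\<forall>(p, q, r) \<in> set ts. a r = a p + a q))"
  have P: "P [] \<longleftrightarrow> False" "P ((p, q, r) # ts) \<longleftrightarrow> (a r = a p + a q \<longrightarrow> P ts)" for p q r ts
    by (auto simp: P_def)
  have "list_all P (systems 5)"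
    by (code_simp, simp only: ball_simps P One_nat_def, intro conjI TrueI impI)
       (insert assms[unfolded One_nat_def], linarith+)
  then show ?thesis by (simp add: P_def)
qed

lemma no_symmetric_array:
  fixes a :: "nat \<Rightarrow> real" and B :: "nat \<Rightarrow> nat \<Rightarrow> int"
  assumes n: "n = 4 \<or> n = 5"
    and pos: "\<And>i. i < n \<Longrightarrow> a i > 0"
    and mono: "\<And>i j. i \<le> j \<Longrightarrow> j < n \<Longrightarrow> a i \<le> a j"
    and sym: "\<And>i k. i < n \<Longrightarrow> k < n \<Longrightarrow> B i k = B k i"
    and rows: "\<And>i. i < n \<Longrightarrow> \<exists>e p q r. (e = 1 \<or> e = -1) \<and> p \<le> q \<and> q < r \<and> r < n \<and> a r = a p + a q \<and>
      (\<forall>k<n. B i k = e * (of_bool (k = p) + of_bool (k = q) - of_bool (k = r)))"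
    and diag: "\<And>i. i < n \<Longrightarrow> odd (B i i) \<Longrightarrow> B i i = s"
  shows False
proof -
  obtain e p q r where e: "\<And>i. i < n \<Longrightarrow> e i = 1 \<or> e i = -1"
    and pqr: "\<And>i. i < n \<Longrightarrow> p i \<le> q i \<and> q i < r i \<and> r i < n"
    and a: "\<And>i. i < n \<Longrightarrow> a (r i) = a (p i) + a (q i)"
    and B: "\<And>i k. i < n \<Longrightarrow> k < n \<Longrightarrow>
      B i k = e i * (of_bool (k = p i) + of_bool (k = q i) - of_bool (k = r i))"
    using rows by metis
  have n0: "0 < n" using n by auto
  \<comment> \<open>Multiplying the whole matrix by \<open>e 0\<close> makes the first row positive,
    as the enumeration expects. Symmetry survives, and so does the agreement of odd diagonal
    entries, now with common value \<open>e 0 * s\<close>.\<close>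
  define T where "T i = ((p i, q i, r i), shape_row n (e 0 * e i) (p i) (q i) (r i))" for i
  have T_nth: "snd (T i) ! k = e 0 * B i k" if "i < n" "k < n" for i k
    using that by (simp add: T_def nth_shape_row B)
  have "map (fst \<circ> T) [0..<n] \<in> set (systems n)"
  proof (rule systems_complete[OF n0])
    show "T 0 \<in> set (row_shapes n [1])"
      unfolding T_def using e[OF n0] pqr[OF n0] by (intro shape_row_in_row_shapes) auto
    show "T i \<in> set (row_shapes n [1, -1])" if "i < n" for i
      unfolding T_def using e[OF n0] e[OF that] pqr[OF that]
      by (intro shape_row_in_row_shapes) auto
    show "snd (T i) ! k = snd (T k) ! i" if "i < n" "k < n" for i k
      using that sym by (simp add: T_nth)
    show "snd (T i) ! i = e 0 * s" if "i < n" "odd (snd (T i) ! i)" for i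
      using that diag by (simp add: T_nth)
  qed
  moreover have "list_all (\<lambda>ts. \<not> (\<forall>(p, q, r) \<in> set ts. a r = a p + a q)) (systems n)"
    using n
  proof
    assume "n = 4"
    then show ?thesis using systems_4_infeasible[of a] pos mono by simp
  next
    assume "n = 5"
    then show ?thesis using systems_5_infeasible[of a] pos mono by simp
  qed
  ultimately have "\<not> (\<forall>(p, q, r) \<in> set (map (fst \<circ> T) [0..<n]). a r = a p + a q)"
    by (simp only: list_all_iff) blast
  then show False
    using a by (auto simp: T_def)
qed

section \<open>Cyclic groups of automorphisms\<close>

definition forward_orbit :: "('v \<Rightarrow> 'v) \<Rightarrow> 'v \<Rightarrow> 'v set" where
  "forward_orbit f v = range (\<lambda>i::nat. (f ^^ i) v)"

lemma self_in_forward_orbit: "v \<in> forward_orbit f v"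
  unfolding forward_orbit_def by (rule range_eqI[of _ _ 0]) simp

text \<open>A generator of the cyclic group serves as \<open>f\<close>: the group is finite, so its
  elements are the powers of \<open>f\<close> with natural exponents and its orbits are the forward
  orbits.\<close>

lemma l_circulantE:
  fixes E :: "'v::finite \<Rightarrow> 'v \<Rightarrow> bool"
  assumes "l_circulant l E"
  obtains f where "bij f" "\<And>u v. E (f u) (f v) \<longleftrightarrow> E u v"
    "card (range (forward_orbit f)) = l"
    "\<And>u v. card (forward_orbit f u) = card (forward_orbit f v)"
proof -
  define A where "A = automorphism_group E"
  from assms obtain H where H: "subgroup H A"
    and cyc: "cyclic_group (A\<lparr>carrier := H\<rparr>)"
    and l: "card (orbits (A\<lparr>carrier := H\<rparr>) UNIV (\<lambda>g. g)) = l"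
    and eq: "\<And>B C. B \<in> orbits (A\<lparr>carrier := H\<rparr>) UNIV (\<lambda>g. g) \<Longrightarrow>
      C \<in> orbits (A\<lparr>carrier := H\<rparr>) UNIV (\<lambda>g. g) \<Longrightarrow> card B = card C"
    unfolding l_circulant_def Let_def A_def by blast
  define G where "G = A\<lparr>carrier := H\<rparr>"
  interpret G: group G
    unfolding G_def A_def using H group_automorphism_group A_def
    by (metis subgroup.subgroup_is_group)
  from cyc obtain f where f: "f \<in> carrier G" and gen: "subgroup_generated G {f} = G"
    unfolding G_def[symmetric] cyclic_group_def by blast
  have H_aut: "H \<subseteq> graph_automorphisms E"
    using subgroup.subset[OF H] by (simp add: A_def automorphism_group_def)
  have carrier_G: "carrier G = H" by (simp add: G_def)
  have bijf: "bij f" and autf: "\<And>u v. E (f u) (f v) \<longleftrightarrow> E u v"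
    using f H_aut by (auto simp: carrier_G graph_automorphisms_def Bij_def)
  have mult: "g \<otimes>\<^bsub>G\<^esub> h = g \<circ> h" if "g \<in> H" "h \<in> H" for g h
    using that H_aut
    by (auto simp: G_def A_def automorphism_group_def BijGroup_def graph_automorphisms_def
        compose_def fun_eq_iff)
  have one: "\<one>\<^bsub>G\<^esub> = id"
    by (auto simp: G_def A_def automorphism_group_def BijGroup_def)
  have pow: "f [^]\<^bsub>G\<^esub> i = f ^^ i" for i :: nat
  proof (induction i)
    case (Suc i)
    have "f [^]\<^bsub>G\<^esub> i \<in> H" using f carrier_G by auto
    then have "f [^]\<^bsub>G\<^esub> Suc i = f [^]\<^bsub>G\<^esub> i \<circ> f" using f carrier_G by (simp add: mult)
    then show ?case by (simp add: Suc funpow_Suc_right del: funpow.simps)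
  qed (simp add: one)
  have "finite (carrier G)"
    by (rule finite_subset[of _ UNIV]) auto
  then have "generate G {f} = {f [^]\<^bsub>G\<^esub> i | i. i \<in> (UNIV :: nat set)}"
    using f G.generate_pow_on_finite_carrier by blast
  moreover have "carrier G = generate G {f}"
    using arg_cong[OF gen, of carrier] f by (simp add: carrier_subgroup_generated Int_absorb1)
  ultimately have carr: "carrier G = range (\<lambda>i. f ^^ i)"
    by (auto simp: pow)
  have orb: "orbit G (\<lambda>g. g) v = forward_orbit f v" for v
    unfolding orbit_def carr forward_orbit_def by auto
  have orbs: "orbits G UNIV (\<lambda>g. g) = range (forward_orbit f)"
    unfolding orbits_def orb by auto
  show thesis
    by (rule that[of f]) (use bijf autf l eq orbs in \<open>auto simp: G_def\<close>)
qed

text \<open>The exponents below the least period of \<open>v\<close> list its orbit without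
  repetition, so orbit size and least period coincide.\<close>

lemma funpow_eq_self_iff:
  fixes f :: "'v::finite \<Rightarrow> 'v"
  assumes "bij f"
  shows "(f ^^ i) v = v \<longleftrightarrow> card (forward_orbit f v) dvd i"
proof -
  define k where "k = (LEAST k. 0 < k \<and> (f ^^ k) v = v)"
  have inj: "inj (f ^^ i)" for i
    using assms by (simp add: bij_is_inj)
  have cancel: "(f ^^ (j - i)) v = v" if "(f ^^ i) v = (f ^^ j) v" "i \<le> j" for i j
  proof -
    have "(f ^^ i) ((f ^^ (j - i)) v) = (f ^^ i) v"
      using that by (metis comp_apply funpow_add le_add_diff_inverse)
    then show ?thesis using inj by (meson injD)
  qed
  have "\<exists>k. 0 < k \<and> (f ^^ k) v = v"
  proof -
    \<comment> \<open>Pigeonhole: two powers of \<open>f\<close> agree at \<open>v\<close>, and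
      cancelling the smaller one leaves a positive period.\<close>
    have "\<not> inj (\<lambda>i::nat. (f ^^ i) v)"
      using range_inj_infinite finite by blast
    then obtain i j where "(f ^^ i) v = (f ^^ j) v" "i < j"
      unfolding inj_def by (metis linorder_neqE_nat)
    then show ?thesis using cancel[of i j] by (intro exI[of _ "j - i"]) auto
  qed
  then have k: "0 < k" "(f ^^ k) v = v"
    unfolding k_def using LeastI_ex[of "\<lambda>k. 0 < k \<and> (f ^^ k) v = v"] by blast+
  have least: "(f ^^ i) v \<noteq> v" if "0 < i" "i < k" for i
    using that not_less_Least unfolding k_def by blast
  have mod: "(f ^^ (i mod k)) v = (f ^^ i) v" for i
    using funpow_mod_eq[OF k(2)] by simp
  have "forward_orbit f v = (\<lambda>i. (f ^^ i) v) ` {..<k}"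
    unfolding forward_orbit_def
    by (auto simp: image_iff) (metis k(1) lessThan_iff mod mod_less_divisor)
  moreover have "inj_on (\<lambda>i. (f ^^ i) v) {..<k}"
  proof (rule linorder_inj_onI')
    fix i j assume "i \<in> {..<k}" "j \<in> {..<k}" "i < j"
    then show "(f ^^ i) v \<noteq> (f ^^ j) v"
      using cancel[of i j] least[of "j - i"] by auto
  qed
  ultimately have "card (forward_orbit f v) = k" by (simp add: card_image)
  moreover have "(f ^^ i) v = v \<longleftrightarrow> i mod k = 0"
    using mod[of i] least[of "i mod k"] k(1) by (metis funpow_0 mod_less_divisor neq0_conv)
  ultimately show ?thesis by (simp add: mod_eq_0_iff_dvd)
qed

text \<open>Composing a kernel vector with an automorphism gives a kernel vector, hence a multiple
  by some \<open>c\<close>. Permuting the entries preserves the sum of squares, which forces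
  \<open>c\<^sup>2 = 1\<close>.\<close>

lemma nut_graph_kernel_vector:
  fixes E :: "'v::finite \<Rightarrow> 'v \<Rightarrow> bool"
  assumes "nut_graph E" "bij f" "\<And>u v. E (f u) (f v) \<longleftrightarrow> E u v"
  shows "\<exists>x c. (\<forall>v. x v \<noteq> (0::real)) \<and> (\<forall>v. (\<Sum>w | E v w. x w) = 0) \<and>
    (c = 1 \<or> c = -1) \<and> (\<forall>v. x (f v) = c * x v)"
proof -
  from assms(1) obtain y where y: "null_space (adjacency_matrix E) = span {y}" "\<And>v. y $ v \<noteq> 0"
    unfolding nut_graph_def by blast
  have null: "z \<in> null_space (adjacency_matrix E) \<longleftrightarrow> (\<forall>v. (\<Sum>w | E v w. z $ w) = 0)" for z
    by (simp add: null_space_def adjacency_matrix_def vec_eq_iff matrix_vector_mult_def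
        if_distrib[of "\<lambda>t. t * _"] sum.If_cases cong: if_cong)
  have "y \<in> span {y}" by (simp add: span_base)
  then have ky: "(\<Sum>w | E v w. y $ w) = 0" for v
    using null y(1) by blast
  have "(\<Sum>w | E v w. y $ f w) = 0" for v
  proof -
    have "f ` {w. E v w} = {w. E (f v) w}"
      using assms(2,3) by (auto simp: image_iff) (metis bij_pointE)
    moreover have "inj_on f {w. E v w}"
      using assms(2) by (meson bij_is_inj inj_on_subset subset_UNIV)
    ultimately have "(\<Sum>w | E v w. y $ f w) = (\<Sum>w | E (f v) w. y $ w)"
      using sum.reindex[of f "{w. E v w}" "\<lambda>w. y $ w"] by simp
    then show ?thesis using ky by simp
  qed
  then have "(\<chi> v. y $ f v) \<in> span {y}"
    using null[of "\<chi> v. y $ f v"] y(1) by simp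
  then obtain c where "(\<chi> v. y $ f v) = c *\<^sub>R y"
    by (auto simp: span_singleton)
  then have c: "y $ f v = c * y $ v" for v
    by (metis vec_lambda_beta vector_scaleR_component real_scaleR_def)
  have "(\<Sum>v\<in>UNIV. (y $ v)\<^sup>2) = (\<Sum>v\<in>UNIV. (y $ f v)\<^sup>2)"
    using sum.reindex_bij_betw[OF assms(2), of "\<lambda>v. (y $ v)\<^sup>2"] by simp
  also have "\<dots> = c\<^sup>2 * (\<Sum>v\<in>UNIV. (y $ v)\<^sup>2)"
    by (simp add: c power_mult_distrib sum_distrib_left)
  finally have "(c\<^sup>2 - 1) * (\<Sum>v\<in>UNIV. (y $ v)\<^sup>2) = 0" by (simp add: algebra_simps)
  moreover have "(\<Sum>v\<in>UNIV. (y $ v)\<^sup>2) > 0"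
    using y(2) by (intro sum_pos) auto
  ultimately have "c\<^sup>2 = 1" by auto
  then have "c = 1 \<or> c = -1" by (simp add: power2_eq_1_iff)
  then show ?thesis
    using y(2) ky c by (intro exI[of _ "\<lambda>v. y $ v"] exI[of _ c]) simp
qed

lemma ex_sorted_enumeration:
  fixes key :: "'a \<Rightarrow> 'b::linorder"
  assumes "finite A"
  obtains h where "bij_betw h {..<card A} A"
    "\<And>i j. i \<le> j \<Longrightarrow> j < card A \<Longrightarrow> key (h i) \<le> key (h j)"
proof -
  obtain xs where xs: "set xs = A" "distinct xs"
    using finite_distinct_list[OF assms] by blast
  define ys where "ys = sort_key key xs"
  have ys: "set ys = A" "distinct ys" "length ys = card A"
    using xs distinct_card[of xs] by (auto simp: ys_def)
  have "sorted (map key ys)" by (simp add: ys_def)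
  then have "key (ys ! i) \<le> key (ys ! j)" if "i \<le> j" "j < card A" for i j
    using that ys(3) sorted_nth_mono[of "map key ys" i j] by simp
  moreover have "bij_betw (nth ys) {..<card A} A"
    using bij_betw_nth[OF ys(2)] ys by simp
  ultimately show thesis using that by blast
qed

lemma forward_orbit_funpow:
  fixes f :: "'v::finite \<Rightarrow> 'v"
  assumes "bij f"
  shows "forward_orbit f ((f ^^ i) v) = forward_orbit f v"
proof -
  have sub: "forward_orbit f ((f ^^ j) u) \<subseteq> forward_orbit f u" for j u
    unfolding forward_orbit_def by (auto simp flip: funpow_add comp_apply[of "_ ^^ _" "_ ^^ _"])
  define m where "m = card (forward_orbit f v)"
  have "0 < m"
    unfolding m_def using self_in_forward_orbit[of v f] by (auto simp: card_gt_0_iff)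
  \<comment> \<open>The exponent \<open>m * i\<close> is a multiple of the orbit size and at least
    \<open>i\<close>, so this many further steps lead from \<open>(f ^^ i) v\<close> back to
    \<open>v\<close>.\<close>
  then have "(f ^^ (m * i - i)) ((f ^^ i) v) = (f ^^ (m * i)) v"
    by (simp flip: funpow_add comp_apply[of "_ ^^ _" "_ ^^ _"])
  also have "\<dots> = v" using funpow_eq_self_iff[OF assms] by (simp add: m_def)
  finally have "forward_orbit f v \<subseteq> forward_orbit f ((f ^^ i) v)"
    using sub[of "m * i - i" "(f ^^ i) v"] by simp
  then show ?thesis using sub by blast
qed

lemma forward_orbit_eq_iff:
  fixes f :: "'v::finite \<Rightarrow> 'v"
  assumes "bij f"
  shows "forward_orbit f u = forward_orbit f v \<longleftrightarrow> u \<in> forward_orbit f v"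
proof
  assume "u \<in> forward_orbit f v"
  then obtain i where "u = (f ^^ i) v" by (auto simp: forward_orbit_def)
  then show "forward_orbit f u = forward_orbit f v" using forward_orbit_funpow[OF assms] by simp
qed (metis self_in_forward_orbit)

section \<open>The signed quotient matrix\<close>

text \<open>One-dimensionality of the kernel enters through \<open>x_f\<close>.\<close>

locale cubic_kernel_vector =
  fixes E :: "'v::finite \<Rightarrow> 'v \<Rightarrow> bool" and f :: "'v \<Rightarrow> 'v" and x :: "'v \<Rightarrow> real" and c :: real
  assumes symE: "E u v \<Longrightarrow> E v u"
    and irreflE: "\<not> E v v"
    and card_nbrs: "card {w. E v w} = 3"
    and bij: "bij f"
    and aut: "E (f u) (f v) \<longleftrightarrow> E u v"
    and card_orbit: "card (forward_orbit f u) = card (forward_orbit f v)"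
    and nonzero: "x v \<noteq> 0"
    and kernel: "(\<Sum>w | E v w. x w) = 0"
    and c: "c = 1 \<or> c = -1"
    and x_f: "x (f v) = c * x v"
begin

definition sigma :: "'v \<Rightarrow> int" where "sigma v = (if x v > 0 then 1 else -1)"

text \<open>With an orbit for \<open>A\<close> this is an entry of the signed quotient matrix. The
  factor \<open>sigma v\<close> makes it constant along the orbit of \<open>v\<close> even when
  \<open>c = -1\<close>, since \<open>f\<close> then flips both signs.\<close>

definition signed_count :: "'v \<Rightarrow> 'v set \<Rightarrow> int" where
  "signed_count v A = (\<Sum>w | w \<in> A \<and> E v w. sigma v * sigma w)"

text \<open>Any vertex may replace \<open>undefined\<close>, as all orbits have the same size.\<close>

definition half_turn_sign :: int where
  "half_turn_sign = (if c = 1 then 1 else (-1) ^ (card (forward_orbit f undefined) div 2))"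

lemma x_eq_sigma: "x v = sigma v * \<bar>x v\<bar>"
  by (simp add: sigma_def)

lemma sigma_cases: "sigma v = 1 \<or> sigma v = -1"
  by (simp add: sigma_def)

lemma sigma_f: "sigma (f v) = (if c = 1 then 1 else -1) * sigma v"
  using c nonzero[of v] by (auto simp: sigma_def x_f)

lemma sigma_funpow: "sigma ((f ^^ i) v) = (if c = 1 then 1 else (-1) ^ i) * sigma v"
  by (induction i) (auto simp: sigma_f)

lemma aut_funpow: "E ((f ^^ i) u) ((f ^^ i) v) \<longleftrightarrow> E u v"
  by (induction i) (auto simp: aut)

lemma abs_x_orbit: "u \<in> forward_orbit f v \<Longrightarrow> \<bar>x u\<bar> = \<bar>x v\<bar>"
proof -
  have "\<bar>x ((f ^^ i) v)\<bar> = \<bar>x v\<bar>" for i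
    using c by (induction i) (auto simp: x_f abs_mult)
  then show "u \<in> forward_orbit f v \<Longrightarrow> \<bar>x u\<bar> = \<bar>x v\<bar>" by (auto simp: forward_orbit_def)
qed

lemma f_in_orbit_iff: "f u \<in> forward_orbit f v \<longleftrightarrow> u \<in> forward_orbit f v"
proof -
  have "forward_orbit f (f u) = forward_orbit f u"
    using forward_orbit_funpow[OF bij, of 1 u] by simp
  then show ?thesis by (simp flip: forward_orbit_eq_iff[OF bij])
qed

lemma signed_count_f: "signed_count (f v) (forward_orbit f u) = signed_count v (forward_orbit f u)"
proof -
  have "bij_betw f {w. w \<in> forward_orbit f u \<and> E v w} {w. w \<in> forward_orbit f u \<and> E (f v) w}"
    unfolding bij_betw_def
  proof
    show "inj_on f {w. w \<in> forward_orbit f u \<and> E v w}"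
      using bij by (meson bij_is_inj inj_on_subset subset_UNIV)
    show "f ` {w. w \<in> forward_orbit f u \<and> E v w} = {w. w \<in> forward_orbit f u \<and> E (f v) w}"
      using bij by (auto simp: f_in_orbit_iff aut image_iff) (metis aut bij_pointE f_in_orbit_iff)
  qed
  from sum.reindex_bij_betw[OF this, of "\<lambda>w. sigma (f v) * sigma w"]
  show ?thesis by (cases "c = 1") (simp_all add: signed_count_def sigma_f)
qed

lemma signed_count_orbit:
  "w \<in> forward_orbit f v \<Longrightarrow> signed_count w (forward_orbit f u) = signed_count v (forward_orbit f u)"
proof -
  have "signed_count ((f ^^ i) v) (forward_orbit f u) = signed_count v (forward_orbit f u)" for i
    by (induction i) (auto simp: signed_count_f)
  then show "w \<in> forward_orbit f v \<Longrightarrow> ?thesis" by (auto simp: forward_orbit_def)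
qed

text \<open>Double counting of the signed edges between two orbits: each vertex of an orbit
  contributes equally, and the common orbit size cancels.\<close>

lemma signed_count_commute:
  "signed_count u (forward_orbit f v) = signed_count v (forward_orbit f u)"
proof -
  have double: "(\<Sum>w\<in>forward_orbit f u. signed_count w (forward_orbit f v)) =
      card (forward_orbit f u) * signed_count u (forward_orbit f v)" for u v
    using signed_count_orbit by simp
  have expand: "(\<Sum>w\<in>forward_orbit f u. signed_count w (forward_orbit f v)) =
    (\<Sum>w\<in>forward_orbit f u. \<Sum>z\<in>forward_orbit f v. if E w z then sigma w * sigma z else 0)" for u v
    unfolding signed_count_def by (intro sum.cong refl sum.mono_neutral_cong_left) auto
  have "(\<Sum>w\<in>forward_orbit f u. signed_count w (forward_orbit f v)) =
      (\<Sum>w\<in>forward_orbit f v. signed_count w (forward_orbit f u))"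
    unfolding expand by (subst sum.swap) (auto intro!: sum.cong simp: mult.commute dest: symE)
  moreover have "card (forward_orbit f u) \<noteq> 0"
    using self_in_forward_orbit[of u f] by auto
  ultimately show ?thesis
    unfolding double using card_orbit[of u v] by simp
qed

text \<open>Signs are odd, so \<open>v\<close> has an odd number of neighbours in its own orbit.
  Three are impossible, and a single one must be the image of \<open>v\<close> under the half
  turn.\<close>

lemma odd_signed_count_self:
  assumes odd: "odd (signed_count v (forward_orbit f v))"
  shows "signed_count v (forward_orbit f v) = half_turn_sign"
proof -
  define N where "N = {w. w \<in> forward_orbit f v \<and> E v w}"
  define m where "m = card (forward_orbit f v)"
  have m0: "0 < m"
    unfolding m_def using self_in_forward_orbit[of v f] by (auto simp: card_gt_0_iff)
  have oddN: "odd (\<Sum>w\<in>N. sigma w)"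
    using odd unfolding signed_count_def N_def[symmetric]
    by (metis even_mult_iff sum_distrib_left)
  have "even (sigma w - 1)" for w using sigma_cases[of w] by auto
  then have "even (\<Sum>w\<in>N. sigma w - 1)" by (rule dvd_sum)
  then have "odd (card N)"
    using oddN by (simp add: sum_subtractf)
  moreover have "card N \<noteq> 3"
  proof
    assume "card N = 3"
    then have "N = {w. E v w}"
      using card_nbrs[of v] by (intro card_subset_eq) (auto simp: N_def)
    \<comment> \<open>If all neighbours lie in the orbit of \<open>v\<close>, they share the value
      \<open>\<bar>x v\<bar>\<close>, so the kernel equation makes the sum of signs zero, which is
      even.\<close>
    then have "0 = (\<Sum>w\<in>N. x w)" using kernel by simp
    also have "\<dots> = (\<Sum>w\<in>N. sigma w * \<bar>x v\<bar>)"
      by (intro sum.cong refl) (metis (mono_tags, lifting) N_def abs_x_orbit mem_Collect_eq x_eq_sigma)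
    also have "\<dots> = of_int (\<Sum>w\<in>N. sigma w) * \<bar>x v\<bar>" by (simp add: sum_distrib_right)
    finally have "(\<Sum>w\<in>N. sigma w) = 0"
      using nonzero[of v] by (metis abs_eq_0 mult_eq_0_iff of_int_eq_0_iff)
    with oddN show False by simp
  qed
  moreover have "card N \<le> 3"
    using card_mono[of "{w. E v w}" N] card_nbrs[of v] by (auto simp: N_def)
  ultimately have "card N = 1"
    by (metis One_nat_def Suc_1 even_numeral le_Suc_eq le_zero_eq even_zero numeral_3_eq_3)
  then obtain w where N: "N = {w}" by (auto simp: card_1_singleton_iff)
  then have w: "w \<in> forward_orbit f v" "E v w" by (auto simp: N_def)
  then obtain i' where "w = (f ^^ i') v" by (auto simp: forward_orbit_def)
  define i where "i = i' mod m"
  have per: "(f ^^ m) v = v" using funpow_eq_self_iff[OF bij] by (simp add: m_def)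
  have wi: "w = (f ^^ i) v"
    using \<open>w = _\<close> funpow_mod_eq[OF per] by (simp add: i_def)
  have "i < m" using m0 by (simp add: i_def)
  have "i \<noteq> 0" using w(2) wi irreflE by (metis funpow_0)
  have cancel: "(f ^^ (m - i)) w = v"
    using per \<open>i < m\<close> by (simp add: wi flip: funpow_add comp_apply[of "_ ^^ _" "_ ^^ _"])
  \<comment> \<open>Rotating the edge back gives a neighbour at exponent \<open>m - i\<close>;
    uniqueness identifies it with the one at \<open>i\<close>, so \<open>m\<close> divides
    \<open>2 * i\<close>, where \<open>0 < i < m\<close>.\<close>
  have "E ((f ^^ (m - i)) v) v"
    using aut_funpow[of "m - i" v w] w(2) cancel by simp
  then have "(f ^^ (m - i)) v \<in> N" using symE by (auto simp: N_def forward_orbit_def)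
  then have "(f ^^ (m - i)) v = (f ^^ i) v" using N wi by simp
  then have "(f ^^ (i + i)) v = (f ^^ i) ((f ^^ (m - i)) v)" by (simp add: funpow_add)
  also have "\<dots> = v"
    using per \<open>i < m\<close> by (simp flip: funpow_add comp_apply[of "_ ^^ _" "_ ^^ _"])
  finally have "m dvd i + i" using funpow_eq_self_iff[OF bij] m_def by blast
  then obtain k where k: "i + i = m * k" by blast
  have "k = 1"
  proof -
    have "m * k < m * 2" "m * k > 0" using k \<open>i < m\<close> \<open>i \<noteq> 0\<close> by linarith+
    then show ?thesis by simp
  qed
  then have "i = m div 2" using k by simp
  moreover have "card (forward_orbit f undefined) = m" unfolding m_def by (rule card_orbit)
  ultimately have "sigma w = half_turn_sign * sigma v"
    unfolding wi sigma_funpow half_turn_sign_def by simp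
  then show ?thesis
    unfolding signed_count_def N_def[symmetric] N using sigma_cases[of v] by auto
qed

lemma card_orbits_not_4_or_5:
  "card (range (forward_orbit f)) \<noteq> 4 \<and> card (range (forward_orbit f)) \<noteq> 5"
proof (rule ccontr)
  assume asm: "\<not> ?thesis"
  define n where "n = card (range (forward_orbit f))"
  have n: "n = 4 \<or> n = 5" using asm by (simp add: n_def)
  \<comment> \<open>The choice of representative is harmless because \<open>\<bar>x\<bar>\<close> is
    constant on orbits.\<close>
  define key where "key A = \<bar>x (SOME v. v \<in> A)\<bar>" for A
  have key: "key (forward_orbit f v) = \<bar>x v\<bar>" for v
    unfolding key_def by (rule abs_x_orbit, rule someI, rule self_in_forward_orbit)
  obtain h where h: "bij_betw h {..<n} (range (forward_orbit f))"
    and mono: "\<And>i j. i \<le> j \<Longrightarrow> j < n \<Longrightarrow> key (h i) \<le> key (h j)"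
    using ex_sorted_enumeration[of "range (forward_orbit f)" key] unfolding n_def by auto
  define idx where "idx v = inv_into {..<n} h (forward_orbit f v)" for v
  have h_idx: "h (idx v) = forward_orbit f v" for v
    unfolding idx_def using h by (simp add: bij_betw_inv_into_right)
  have idx_less: "idx v < n" for v
    unfolding idx_def using h by (metis bij_betw_imp_surj_on inv_into_into lessThan_iff rangeI)
  define rep where "rep i = (SOME v. h i = forward_orbit f v)" for i
  have h_rep: "h i = forward_orbit f (rep i)" if "i < n" for i
  proof -
    have "h i \<in> range (forward_orbit f)" using h that by (auto simp: bij_betw_def)
    then obtain v where "h i = forward_orbit f v" by blast
    then show ?thesis unfolding rep_def by (rule someI)
  qed
  have in_h: "w \<in> h k \<longleftrightarrow> idx w = k" if "k < n" for w k
  proof -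
    have "w \<in> h k \<longleftrightarrow> h (idx w) = h k"
      using that by (simp add: h_rep h_idx forward_orbit_eq_iff[OF bij])
    also have "\<dots> \<longleftrightarrow> idx w = k"
      using h that idx_less by (auto simp: bij_betw_def inj_on_eq_iff)
    finally show ?thesis .
  qed
  define a where "a i = key (h i)" for i
  have a_idx: "a (idx v) = \<bar>x v\<bar>" for v by (simp add: a_def h_idx key)
  define B where "B i k = signed_count (rep i) (h k)" for i k
  show False
  proof (rule no_symmetric_array[OF n])
    show "a i > 0" if "i < n" for i
      using that nonzero by (simp add: a_def h_rep key)
    show "a i \<le> a j" if "i \<le> j" "j < n" for i j
      using mono[OF that] by (simp add: a_def)
    show "B i k = B k i" if "i < n" "k < n" for i k
      using that by (simp add: B_def h_rep signed_count_commute)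
    show "B i i = half_turn_sign" if "i < n" "odd (B i i)" for i
      using that odd_signed_count_self by (simp add: B_def h_rep)
    show "\<exists>e p q r. (e = 1 \<or> e = -1) \<and> p \<le> q \<and> q < r \<and> r < n \<and> a r = a p + a q \<and>
      (\<forall>k<n. B i k = e * (of_bool (k = p) + of_bool (k = q) - of_bool (k = r)))" if "i < n" for i
    proof -
      define v where "v = rep i"
      obtain xs where xs: "set xs = {w. E v w}" "distinct xs"
        using finite_distinct_list[of "{w. E v w}"] by auto
      \<comment> \<open>Orbits are numbered by increasing \<open>\<bar>x\<bar>\<close>, so sorting
        the neighbours by orbit index also sorts them by \<open>\<bar>x\<bar>\<close>.\<close>
      define ys where "ys = sort_key idx xs"
      have ys: "set ys = {w. E v w}" "distinct ys" "sorted (map idx ys)"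
        using xs by (simp_all add: ys_def)
      then have "length ys = 3"
        using distinct_card[of ys] card_nbrs[of v] by simp
      then obtain w1 w2 w3 where w: "ys = [w1, w2, w3]"
        by (auto simp: numeral_3_eq_3 length_Suc_conv)
      have nbrs: "{w. E v w} = {w1, w2, w3}" and dist: "w1 \<noteq> w2" "w1 \<noteq> w3" "w2 \<noteq> w3"
        using ys w by auto
      have le: "idx w1 \<le> idx w2" "idx w2 \<le> idx w3"
        using ys(3) by (auto simp: w)
      have abs_le: "\<bar>x w1\<bar> \<le> \<bar>x w2\<bar>" "\<bar>x w2\<bar> \<le> \<bar>x w3\<bar>"
        using mono[OF le(1) idx_less] mono[OF le(2) idx_less] by (simp_all add: h_idx key)
      have sum0: "x w1 + x w2 + x w3 = 0"
        using kernel[of v] dist by (simp add: nbrs add.assoc)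
      \<comment> \<open>If \<open>w3\<close> shared its sign with \<open>w1\<close> or
        \<open>w2\<close>, the remaining neighbour would have to balance both and exceed the largest
        absolute value.\<close>
      have signs: "sigma w2 = sigma w1" "sigma w3 = - sigma w1"
        and abs_sum: "\<bar>x w3\<bar> = \<bar>x w1\<bar> + \<bar>x w2\<bar>"
        using sum0 abs_le nonzero[of w1] nonzero[of w2] nonzero[of w3]
        by (auto simp: sigma_def abs_if split: if_splits)
      \<comment> \<open>Since \<open>x w1\<close> is nonzero, \<open>\<bar>x w3\<bar>\<close>
        strictly exceeds \<open>\<bar>x w2\<bar>\<close>; this gives the strict inequality
        \<open>q < r\<close>.\<close>
      have "idx w2 \<noteq> idx w3"
        using abs_sum nonzero[of w1] a_idx[of w2] a_idx[of w3] by auto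
      then have "idx w2 < idx w3" using le by simp
      moreover have "B i k = sigma v * sigma w1 *
          (of_bool (k = idx w1) + of_bool (k = idx w2) - of_bool (k = idx w3))" if "k < n" for k
      proof -
        have "B i k = (\<Sum>w | E v w. if idx w = k then sigma v * sigma w else 0)"
          unfolding B_def v_def[symmetric] signed_count_def
          using that by (intro sum.mono_neutral_cong_left) (auto simp: in_h)
        also have "\<dots> = sigma v * sigma w1 *
          (of_bool (k = idx w1) + of_bool (k = idx w2) - of_bool (k = idx w3))"
          unfolding nbrs using dist by (auto simp: signs)
        finally show ?thesis .
      qed
      moreover have "sigma v * sigma w1 = 1 \<or> sigma v * sigma w1 = -1"
        using sigma_cases[of v] sigma_cases[of w1] by auto
      ultimately show ?thesis
        using le(1) idx_less abs_sum a_idx by metis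
    qed
  qed
qed

end

section \<open>Transfer to cubic nut graphs\<close>

lemma cubic_nut_graph_not_4_or_5_circulant:
  fixes E :: "'v::finite \<Rightarrow> 'v \<Rightarrow> bool"
  assumes "cubic E" "l_circulant l E" "nut_graph E"
  shows "l \<noteq> 4 \<and> l \<noteq> 5"
proof -
  obtain f where f: "bij f" "\<And>u v. E (f u) (f v) \<longleftrightarrow> E u v"
    "card (range (forward_orbit f)) = l"
    "\<And>u v. card (forward_orbit f u) = card (forward_orbit f v)"
    by (rule l_circulantE[OF assms(2)]) (rule that)
  obtain x :: "'v \<Rightarrow> real" and c where x: "\<And>v. x v \<noteq> 0" "\<And>v. (\<Sum>w | E v w. x w) = 0"
    "c = 1 \<or> c = -1" "\<And>v. x (f v) = c * x v"
    using nut_graph_kernel_vector[OF assms(3) f(1,2)] by blast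
  have "symp E" "irreflp E"
    using assms(3) by (auto simp: nut_graph_def simple_graph_def)
  then interpret cubic_kernel_vector E f x c
    using assms(1) f x
    by unfold_locales (auto simp: cubic_def dest: sympD irreflpD)
  show ?thesis using card_orbits_not_4_or_5 f(3) by simp
qed

theorem theorem8:
  shows "(\<nexists>E :: 'v::finite \<Rightarrow> 'v \<Rightarrow> bool. cubic E \<and> l_circulant 4 E \<and> nut_graph E) \<and>
         (\<nexists>E :: 'w::finite \<Rightarrow> 'w \<Rightarrow> bool. cubic E \<and> l_circulant 5 E \<and> nut_graph E)"
  by (auto dest: cubic_nut_graph_not_4_or_5_circulant)

end
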